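(* Let $\mathcal{X}\subseteq\mathbb{R}^n$ and let $f:\mathbb{R}^n\to\mathbb{R}$ be a function. If a concave tent of $f$ over $\mathcal{X}$, say $g$, exists, then for the optimization problems $$\inf_{\mathbf{x}\in\mathcal{X}} f(\mathbf{x})\qquad\text{and}\qquad \inf_{\mathbf{x}\in\operatorname{conv}(\mathcal{X})} g(\mathbf{x})$$ the following hold: (a) Every strict local minimizer of the latter problem is a strict local minimizer of the former. (b) We have $\inf_{\mathbf{x}\in\mathcal{X}} f(\mathbf{x})=\inf_{\mathbf{x}\in\operatorname{conv}(\mathcal{X})} g(\mathbf{x})$, and the two problems have the same global minimizers.
   Context: $\operatorname{conv}(\mathcal{X})$ denotes the convex hull of $\mathcal{X}$. Given $\mathcal{X}\subseteq\mathbb{R}^n$ and a function $f:\mathbb{R}^n\to\mathbb{R}$, a concave tent of $f$ over $\mathcal{X}$ is any function $g:\mathbb{R}^n\to\mathbb{R}$ such that (i) $g$ is concave over $\operatorname{conv}(\mathcal{X})$, and (ii) $f(\mathbf{x})=g(\mathbf{x})$ for all $\mathbf{x}\in\mathcal{X}$. A point $\mathbf{x}\in\mathcal{M}$ is a strict local minimizer of a function $\phi$ over a set $\mathcal{M}\subseteq\mathbb{R}^n$ if there is $\varepsilon>0$ such that $\phi(\mathbf{x})<\phi(\mathbf{y})$ for all $\mathbf{y}\in\mathcal{M}\setminus\{\mathbf{x}\}$ with $\|\mathbf{y}-\mathbf{x}\|_2\le\varepsilon$.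
   Formalization: "The same global minimizers" fails literally (X={0,1}, f=g=0). Proved instead: the global minimizers of f over X are exactly those of g over conv(X) that lie in X, and every global minimizer of g over conv(X) is a convex combination of global minimizers of f over X. *)

theory Defs
  imports "HOL-Analysis.Analysis"
begin

definition concave_tent ::
    "('a::real_vector) set \<Rightarrow> ('a \<Rightarrow> real) \<Rightarrow> ('a \<Rightarrow> real) \<Rightarrow> bool"
  where "concave_tent X f g \<longleftrightarrow>
    concave_on (convex hull X) g \<and> (\<forall>x\<in>X. f x = g x)"

definition strict_local_minimizer ::
    "('a::real_normed_vector \<Rightarrow> real) \<Rightarrow> 'a set \<Rightarrow> 'a \<Rightarrow> bool"
  where "strict_local_minimizer \<phi> M x \<longleftrightarrow>
    x \<in> M \<and> (\<exists>\<epsilon>>0. \<forall>y \<in> M - {x}. norm (y - x) \<le> \<epsilon> \<longrightarrow> \<phi> x < \<phi> y)"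

definition global_minimizers :: "('a \<Rightarrow> real) \<Rightarrow> 'a set \<Rightarrow> 'a set"
  where "global_minimizers \<phi> M = {x. is_arg_min \<phi> (\<lambda>y. y \<in> M) x}"

text \<open>
  The sets of global minimizers of \<open>f\<close> over \<open>X\<close> and of a concave tent \<open>g\<close> over
  \<open>convex hull X\<close> need not be equal: for \<open>X = {0, 1}\<close> and \<open>f = g = 0\<close> they are
  \<open>{0, 1}\<close> and \<open>{0..1}\<close>. That the two problems have the same global minimizers is
  therefore expressed by the sets agreeing on \<open>X\<close>, together with every global minimizer of
  the problem over \<open>convex hull X\<close> being a convex combination of these common minimizers.
\<close>

end

theory Submission
  imports Defs
begin

text \<open>
  Two observations about a concave function \<open>g\<close> carry the proof.

  Passing strictly above a level is absorbing: if one of two points lies strictly above the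
  level \<open>m\<close> and the other at or above it, then so does every point strictly between
  them. Hence the points above \<open>m\<close> form a convex set, and the set remains convex when any
  convex set of points at or above \<open>m\<close> is added to it (\<open>convex_Un_strict_superlevel\<close>).
  A convex set that contains \<open>X\<close> contains \<open>convex hull X\<close>. Adding nothing gives
  that no value of \<open>g\<close> on the hull lies below all values on \<open>X\<close>, which yields the
  equality of the infima and of the minimizers in \<open>X\<close>. For \<open>m\<close> the minimum, adding
  the hull of the minimizers in \<open>X\<close> gives that every minimizer lies in that hull.

  On a segment, a concave function is at an interior point at least as large as at one of
  two points close by on either side. So a strict local minimizer over a convex set lies
  inside no segment of the set; it is an extreme point, and the extreme points of
  \<open>convex hull X\<close> belong to \<open>X\<close>.
\<close>

section \<open>Superlevel sets of concave functions\<close>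

text \<open>
  Combinations of two points of \<open>K\<close> stay in \<open>K\<close>. Any other proper combination
  gives positive weight to a point above the level, so the weighted average of the two values
  exceeds \<open>m\<close>.
\<close>

lemma convex_Un_strict_superlevel:
  fixes g :: "'a::real_vector \<Rightarrow> real"
  assumes conc: "concave_on S g"
    and K: "convex K" "K \<subseteq> {z \<in> S. m \<le> g z}"
  shows "convex (K \<union> {z \<in> S. m < g z})"
proof -
  have S: "convex S"
    using conc by (rule concave_on_imp_convex)
  have above: "u *\<^sub>R x + v *\<^sub>R y \<in> {z \<in> S. m < g z}"
    if "x \<in> S" "y \<in> S" "m < g x" "m \<le> g y" "0 < u" "0 \<le> v" "u + v = 1" for x y u v
  proof -
    have "m = u * m + v * m"
      using \<open>u + v = 1\<close> by (metis distrib_right mult_1)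
    also have "\<dots> < u * g x + v * g y"
      using that by (intro add_less_le_mono mult_strict_left_mono mult_left_mono) auto
    also have "\<dots> \<le> g (u *\<^sub>R x + v *\<^sub>R y)"
      using conc that by (auto simp: concave_on_iff)
    finally show ?thesis
      using S that by (auto simp: convexD)
  qed
  show ?thesis
  proof (rule convexI)
    fix x y and u v :: real
    assume xy: "x \<in> K \<union> {z \<in> S. m < g z}" "y \<in> K \<union> {z \<in> S. m < g z}"
      and uv: "0 \<le> u" "0 \<le> v" "u + v = 1"
    have ge: "x \<in> S" "y \<in> S" "m \<le> g x" "m \<le> g y"
      using xy K(2) by auto
    consider "u = 0" | "v = 0" | "x \<in> K" "y \<in> K"
      | "0 < u" "m < g x" | "0 < v" "m < g y"
      using xy uv by fastforce
    then show "u *\<^sub>R x + v *\<^sub>R y \<in> K \<union> {z \<in> S. m < g z}"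
    proof cases
      case 1
      then show ?thesis using xy uv by simp
    next
      case 2
      then show ?thesis using xy uv by simp
    next
      case 3
      then show ?thesis using K(1) uv by (auto simp: convexD)
    next
      case 4
      then show ?thesis using above[of x y u v] ge uv by simp
    next
      case 5
      then show ?thesis using above[of y x v u] ge uv by (simp add: add.commute)
    qed
  qed
qed

text \<open>
  The compared value is attained on \<open>X\<close>, although \<open>g\<close> may have no minimum there: if
  all of \<open>X\<close> were strictly above the level \<open>g y\<close>, so would be \<open>y\<close> itself.
\<close>

lemma concave_on_hull_dominates_vertex:
  fixes g :: "'a::real_vector \<Rightarrow> real"
  assumes conc: "concave_on (convex hull X) g" and y: "y \<in> convex hull X"
  obtains x where "x \<in> X" "g x \<le> g y"
proof -
  have "\<exists>x\<in>X. g x \<le> g y"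
  proof (rule ccontr)
    assume "\<not> ?thesis"
    then have "X \<subseteq> {z \<in> convex hull X. g y < g z}"
      by (auto simp: not_le hull_inc)
    moreover have "convex {z \<in> convex hull X. g y < g z}"
      using convex_Un_strict_superlevel[OF conc, of "{}"] by simp
    ultimately have "convex hull X \<subseteq> {z \<in> convex hull X. g y < g z}"
      by (rule hull_minimal)
    with y show False by auto
  qed
  then show thesis using that by auto
qed

section \<open>Strict local minimizers are extreme points\<close>

text \<open>
  Inside a segment, two points symmetric about \<open>x\<close> can be chosen within the radius of strict
  minimality; both values would exceed \<open>g x\<close>, against midpoint concavity.
\<close>

lemma strict_local_minimizer_extreme_point:
  fixes g :: "'a::real_normed_vector \<Rightarrow> real"
  assumes conc: "concave_on S g" and min: "strict_local_minimizer g S x"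
  shows "x extreme_point_of S"
proof -
  have S: "convex S"
    using conc by (rule concave_on_imp_convex)
  from min obtain e where "x \<in> S" "0 < e"
    and less: "\<And>y. y \<in> S \<Longrightarrow> y \<noteq> x \<Longrightarrow> norm (y - x) \<le> e \<Longrightarrow> g x < g y"
    unfolding strict_local_minimizer_def by auto
  have False if "a \<in> S" "b \<in> S" "x \<in> open_segment a b" for a b
  proof -
    obtain u where u: "a \<noteq> b" "0 < u" "u < 1" "x = (1 - u) *\<^sub>R a + u *\<^sub>R b"
      using \<open>x \<in> open_segment a b\<close> by (auto simp: in_segment)
    \<comment> \<open>The first two bounds keep the shifted points on the segment, the third within the radius.\<close>
    define t where "t = min (min u (1 - u)) (e / norm (b - a))"
    have t: "0 < t" "t \<le> u" "t \<le> 1 - u" "t * norm (b - a) \<le> e"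
      using u \<open>0 < e\<close> by (auto simp: t_def min_le_iff_disj simp flip: pos_le_divide_eq)
    have mem: "x + s *\<^sub>R (b - a) \<in> S" if "\<bar>s\<bar> \<le> t" for s
    proof -
      have "x + s *\<^sub>R (b - a) = (1 - (u + s)) *\<^sub>R a + (u + s) *\<^sub>R b"
        using u(4) by (simp add: algebra_simps)
      also have "\<dots> \<in> S"
        using S \<open>a \<in> S\<close> \<open>b \<in> S\<close> that t by (intro convexD_alt) auto
      finally show ?thesis .
    qed
    have gt: "g x < g (x + s *\<^sub>R (b - a))" if "\<bar>s\<bar> = t" for s
      using that t u(1) by (intro less mem) auto
    have "(1/2) *\<^sub>R (x + t *\<^sub>R (b - a)) + (1/2) *\<^sub>R (x + (- t) *\<^sub>R (b - a)) = x"
      by (simp add: algebra_simps flip: scaleR_add_left)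
    moreover have "(1/2) * g (x + t *\<^sub>R (b - a)) + (1/2) * g (x + (- t) *\<^sub>R (b - a))
      \<le> g ((1/2) *\<^sub>R (x + t *\<^sub>R (b - a)) + (1/2) *\<^sub>R (x + (- t) *\<^sub>R (b - a)))"
      using conc t(1) mem[of t] mem[of "- t"]
      by (intro concave_on_iff[THEN iffD1, THEN conjunct2, rule_format]) auto
    ultimately show False
      using gt[of t] gt[of "- t"] t(1) by simp
  qed
  with \<open>x \<in> S\<close> show ?thesis
    unfolding extreme_point_of_def by blast
qed

section \<open>Minimizing a function and its concave tent\<close>

lemma concave_tent_strict_local_minimizer:
  fixes f g :: "'a::real_normed_vector \<Rightarrow> real"
  assumes tent: "concave_tent X f g" and min: "strict_local_minimizer g (convex hull X) x"
  shows "strict_local_minimizer f X x"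
proof -
  have "x extreme_point_of (convex hull X)"
    using tent min by (auto simp: concave_tent_def intro: strict_local_minimizer_extreme_point)
  then have "x \<in> X"
    by (rule extreme_point_of_convex_hull)
  with tent min show ?thesis
    unfolding strict_local_minimizer_def concave_tent_def by (metis Diff_iff hull_inc)
qed

lemma concave_tent_INF_eq:
  fixes f g :: "'a::real_vector \<Rightarrow> real"
  assumes "concave_tent X f g"
  shows "(INF x\<in>X. ereal (f x)) = (INF x\<in>convex hull X. ereal (g x))"
proof (rule INF_eq)
  fix x assume "x \<in> X"
  then show "\<exists>y\<in>convex hull X. ereal (g y) \<le> ereal (f x)"
    using assms by (auto simp: concave_tent_def intro!: bexI[of _ x] hull_inc)
next
  fix y assume "y \<in> convex hull X"
  then obtain x where "x \<in> X" "g x \<le> g y"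
    using assms concave_on_hull_dominates_vertex unfolding concave_tent_def by blast
  then show "\<exists>x\<in>X. ereal (f x) \<le> ereal (g y)"
    using assms by (auto simp: concave_tent_def)
qed

lemma concave_tent_global_minimizers_Int:
  fixes f g :: "'a::real_vector \<Rightarrow> real"
  assumes tent: "concave_tent X f g"
  shows "global_minimizers f X = X \<inter> global_minimizers g (convex hull X)"
proof -
  have "(\<forall>y\<in>X. f x \<le> f y) \<longleftrightarrow> (\<forall>y\<in>convex hull X. g x \<le> g y)" if "x \<in> X" for x
  proof
    assume min: "\<forall>y\<in>X. f x \<le> f y"
    show "\<forall>y\<in>convex hull X. g x \<le> g y"
    proof
      fix y assume "y \<in> convex hull X"
      then obtain z where "z \<in> X" "g z \<le> g y"
        using tent concave_on_hull_dominates_vertex unfolding concave_tent_def by blast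
      with min tent \<open>x \<in> X\<close> show "g x \<le> g y"
        by (force simp: concave_tent_def)
    qed
  next
    assume "\<forall>y\<in>convex hull X. g x \<le> g y"
    with tent \<open>x \<in> X\<close> show "\<forall>y\<in>X. f x \<le> f y"
      by (simp add: concave_tent_def hull_inc)
  qed
  then show ?thesis
    by (auto simp: global_minimizers_def is_arg_min_linorder hull_inc)
qed

text \<open>
  Each point of \<open>X\<close> either is a minimizer or lies strictly above the minimum value, so the
  hull of \<open>X\<close> is covered by the hull of the minimizers in \<open>X\<close> and the points
  above the minimum; a minimizer cannot be among the latter.
\<close>

lemma concave_tent_global_minimizers_subset_hull:
  fixes f g :: "'a::real_vector \<Rightarrow> real"
  assumes tent: "concave_tent X f g"
  shows "global_minimizers g (convex hull X) \<subseteq> convex hull (global_minimizers f X)"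
proof
  fix y assume y: "y \<in> global_minimizers g (convex hull X)"
  let ?K = "convex hull (global_minimizers f X)"
  let ?A = "{z \<in> convex hull X. g y < g z}"
  have yX: "y \<in> convex hull X" and le: "\<And>z. z \<in> convex hull X \<Longrightarrow> g y \<le> g z"
    using y by (auto simp: global_minimizers_def is_arg_min_linorder)
  have "?K \<subseteq> convex hull X"
    by (intro hull_mono) (auto simp: global_minimizers_def is_arg_min_linorder)
  then have "?K \<subseteq> {z \<in> convex hull X. g y \<le> g z}"
    using le by auto
  then have "convex (?K \<union> ?A)"
    using tent by (intro convex_Un_strict_superlevel) (auto simp: concave_tent_def)
  moreover have "X \<subseteq> ?K \<union> ?A"
  proof
    fix x assume "x \<in> X"
    show "x \<in> ?K \<union> ?A"
    proof (cases "g y < g x")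
      case True
      with \<open>x \<in> X\<close> show ?thesis by (auto simp: hull_inc)
    next
      case False
      with le have "x \<in> global_minimizers g (convex hull X)"
        using \<open>x \<in> X\<close> by (force simp: global_minimizers_def is_arg_min_linorder hull_inc)
      with \<open>x \<in> X\<close> have "x \<in> global_minimizers f X"
        by (simp add: concave_tent_global_minimizers_Int[OF tent])
      then show ?thesis by (simp add: hull_inc)
    qed
  qed
  ultimately have "convex hull X \<subseteq> ?K \<union> ?A"
    by (intro hull_minimal)
  with yX show "y \<in> ?K" by auto
qed

theorem theorem3:
  fixes X :: "(real ^ 'n) set" and f g :: "real ^ 'n \<Rightarrow> real"
  assumes "concave_tent X f g"
  shows "(\<forall>x. strict_local_minimizer g (convex hull X) x \<longrightarrow> strict_local_minimizer f X x)
    \<and> (INF x\<in>X. ereal (f x)) = (INF x\<in>convex hull X. ereal (g x))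
    \<and> global_minimizers f X = X \<inter> global_minimizers g (convex hull X)
    \<and> global_minimizers g (convex hull X) \<subseteq> convex hull (global_minimizers f X)"
  by (intro conjI allI impI concave_tent_strict_local_minimizer[OF assms]
      concave_tent_INF_eq[OF assms] concave_tent_global_minimizers_Int[OF assms]
      concave_tent_global_minimizers_subset_hull[OF assms])

end
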